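(* Let $G$ be a connected graph on $n$ vertices with exactly $p$ cut edges which has the maximum Harary spectral radius $\rho(G)$ among all connected graphs on $n$ vertices with exactly $p$ cut edges. Then $G=K_{n-p}(p)$.
   Context: All graphs are simple and finite; equality of graphs means isomorphism. For a connected graph $G$ with vertices $v_1,\dots,v_n$, let $d_{ij}$ be the distance (number of edges of a shortest path) between $v_i$ and $v_j$. The Harary matrix $RD(G)$ is the $n\times n$ matrix with $(i,j)$-entry $1/d_{ij}$ if $i\ne j$ and $0$ if $i=j$. The Harary spectral radius $\rho(G)$ is the spectral radius (largest eigenvalue) of $RD(G)$. A cut edge is an edge whose deletion disconnects the graph. $K_t(r)$ denotes the graph obtained from the complete graph $K_t$ by attaching $r$ pendant edges (to $r$ new vertices) to one single vertex of $K_t$; $K_t(0)$ means $K_t$. *)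

theory Defs
  imports "Jordan_Normal_Form.Spectral_Radius" "Graph_Theory.Graph_Theory"
begin

(* A simple finite graph is a pair_graph: a finite symmetric loop-free digraph without
   parallel arcs. An undirected edge {u,v} is represented by the two arcs (u,v) and (v,u). *)

definition graph_dist :: "'a pair_pre_digraph \<Rightarrow> 'a \<Rightarrow> 'a \<Rightarrow> real" where
  "graph_dist G u v = real_of_ereal (wf_digraph.\<mu> (with_proj G) (\<lambda>_. 1) u v)"

definition harary_matrix :: "'a pair_pre_digraph \<Rightarrow> 'a list \<Rightarrow> real mat" where
  "harary_matrix G vs = mat (length vs) (length vs)
     (\<lambda>(i, j). if i = j then 0 else 1 / graph_dist G (vs ! i) (vs ! j))"

(* The choice of the enumeration of the vertices is immaterial, see harary_radius_eq below. *)
definition harary_radius :: "'a pair_pre_digraph \<Rightarrow> real" where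
  "harary_radius G = spectral_radius (map_mat complex_of_real
     (harary_matrix G (SOME vs. distinct vs \<and> set vs = pverts G)))"

definition cut_edges :: "'a pair_pre_digraph \<Rightarrow> 'a set set" where
  "cut_edges G = {{u, v} | u v. (u, v) \<in> parcs G \<and>
     \<not> Digraph_Component.connected (with_proj (G\<lparr>parcs := parcs G - {(u, v), (v, u)}\<rparr>))}"

definition conn_graphs_cut_edges :: "nat \<Rightarrow> nat \<Rightarrow> 'a pair_pre_digraph set" where
  "conn_graphs_cut_edges n p = {G. pair_graph G \<and> Digraph_Component.connected (with_proj G) \<and>
     card (pverts G) = n \<and> card (cut_edges G) = p}"

(* K_t(r), for t > 0: the complete graph lives on {0..<t}, the pendant edges join vertex 0 to
   the r further vertices {t..<t+r}. *)
definition complete_pendant :: "nat \<Rightarrow> nat \<Rightarrow> nat pair_pre_digraph" where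
  "complete_pendant t r = \<lparr> pverts = {0..<t + r},
     parcs = {(i, j). i < t \<and> j < t \<and> i \<noteq> j} \<union>
             {0} \<times> {t..<t + r} \<union> {t..<t + r} \<times> {0} \<rparr>"

lemma pair_graph_complete_pendant:
  assumes "t > 0"
  shows "pair_graph (complete_pendant t r)"
proof
  have "parcs (complete_pendant t r) \<subseteq> {0..<t + r} \<times> {0..<t + r}"
    using assms by (auto simp: complete_pendant_def)
  then show "finite (parcs (complete_pendant t r))"
    by (rule finite_subset) simp
qed (use assms in \<open>auto simp: complete_pendant_def symmetric_def sym_def\<close>)

lemma eigenvalue_harary_matrix_reorder:
  assumes vs: "distinct vs" "set vs = V" and ws: "distinct ws" "set ws = V"
    and ev: "eigenvalue (map_mat complex_of_real (harary_matrix G vs)) k"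
  shows "eigenvalue (map_mat complex_of_real (harary_matrix G ws)) k"
proof -
  let ?A = "map_mat complex_of_real (harary_matrix G vs)"
  let ?B = "map_mat complex_of_real (harary_matrix G ws)"
  let ?n = "length vs"
  have len: "length ws = ?n"
    using vs ws by (metis distinct_card)
  have "\<exists>j<?n. vs ! j = ws ! i" if "i < ?n" for i
    using that vs ws len by (metis in_set_conv_nth nth_mem)
  then obtain f where f: "\<And>i. i < ?n \<Longrightarrow> f i < ?n \<and> vs ! f i = ws ! i"
    by metis
  have inj: "inj_on f {0..<?n}"
    by (rule inj_onI) (metis atLeastLessThan_iff f len nth_eq_iff_index_eq ws(1))
  have bij: "bij_betw f {0..<?n} {0..<?n}"
    unfolding bij_betw_def using inj f by (intro conjI endo_inj_surj) auto
  have entry: "?B $$ (i, j) = ?A $$ (f i, f j)" if "i < ?n" "j < ?n" for i j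
    using that f[of i] f[of j] inj len
    by (auto simp: harary_matrix_def inj_on_def)
  from ev obtain x where x: "x \<in> carrier_vec ?n" "x \<noteq> 0\<^sub>v ?n" "?A *\<^sub>v x = k \<cdot>\<^sub>v x"
    unfolding eigenvalue_def eigenvector_def by (auto simp: harary_matrix_def)
  define y where "y = vec ?n (\<lambda>i. x $ f i)"
  have "?B *\<^sub>v y = k \<cdot>\<^sub>v y"
  proof (rule eq_vecI)
    fix i assume "i < dim_vec (k \<cdot>\<^sub>v y)"
    then have i: "i < ?n" by (simp add: y_def)
    have "(?B *\<^sub>v y) $ i = (\<Sum>j\<in>{0..<?n}. ?B $$ (i, j) * y $ j)"
      using i len by (simp add: scalar_prod_def y_def harary_matrix_def)
    also have "\<dots> = (\<Sum>j\<in>{0..<?n}. ?A $$ (f i, f j) * x $ f j)"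
      using i by (intro sum.cong refl) (simp add: entry y_def)
    also have "\<dots> = (\<Sum>j\<in>{0..<?n}. ?A $$ (f i, j) * x $ j)"
      by (rule sum.reindex_bij_betw[OF bij])
    also have "\<dots> = (?A *\<^sub>v x) $ f i"
      using f[OF i] x(1) by (simp add: scalar_prod_def harary_matrix_def)
    also have "\<dots> = (k \<cdot>\<^sub>v y) $ i"
      using f[OF i] x i by (simp add: y_def)
    finally show "(?B *\<^sub>v y) $ i = (k \<cdot>\<^sub>v y) $ i" .
  qed (simp add: y_def harary_matrix_def len)
  moreover have "y \<noteq> 0\<^sub>v ?n"
  proof
    assume y0: "y = 0\<^sub>v ?n"
    have "x = 0\<^sub>v ?n"
    proof (rule eq_vecI)
      fix j assume "j < dim_vec (0\<^sub>v ?n :: complex vec)"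
      then have "j \<in> f ` {0..<?n}" using bij by (simp add: bij_betw_def)
      then obtain i where i: "i < ?n" "j = f i" by auto
      have "y $ i = 0" using y0 i by simp
      then show "x $ j = 0\<^sub>v ?n $ j" using i f[of i] by (simp add: y_def)
    qed (use x in simp)
    with x show False by simp
  qed
  moreover have "y \<in> carrier_vec ?n" by (simp add: y_def)
  ultimately show ?thesis
    unfolding eigenvalue_def eigenvector_def
    by (intro exI[of _ y]) (simp add: harary_matrix_def len)
qed

lemma harary_radius_eq:
  assumes "distinct vs" "set vs = pverts G"
  shows "harary_radius G = spectral_radius (map_mat complex_of_real (harary_matrix G vs))"
proof -
  define ws where "ws = (SOME vs. distinct vs \<and> set vs = pverts G)"
  have ws: "distinct ws" "set ws = pverts G"
    using someI[of "\<lambda>vs. distinct vs \<and> set vs = pverts G" vs] assms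
    by (auto simp: ws_def)
  have "eigenvalue (map_mat complex_of_real (harary_matrix G ws)) =
        eigenvalue (map_mat complex_of_real (harary_matrix G vs))"
    using eigenvalue_harary_matrix_reorder[OF ws assms]
      eigenvalue_harary_matrix_reorder[OF assms ws] by blast
  then show ?thesis
    by (simp add: harary_radius_def spectral_radius_def spectrum_def flip: ws_def)
qed

end

theory Submission
  imports Defs "HOL-Analysis.Function_Topology"
begin

text \<open>
The proof compares a maximal graph \<open>G\<close> directly with one graph \<open>H\<close> on the same set \<open>V\<close> of vertices,
using a vector \<open>x\<close> of norm one that maximises the quadratic form of the Harary matrix of \<open>G\<close>.
The maximum is the spectral radius (\<open>spectral_radius_eq_quad_form_maximum\<close>), and \<open>x\<close> can be taken
nonnegative; it is then positive on \<open>V\<close>.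

Distinct nonadjacent vertices have distance at least two. So the form of \<open>G\<close> at \<open>x\<close> is at most the
sum of \<open>x u * x v\<close> over the ordered pairs of distinct vertices, where nonadjacent pairs are counted
with the factor 1/2, and equality holds for graphs of diameter at most two. The comparison of the
two forms thus reduces to a comparison of the total weights \<open>x u * x v\<close> of the edges.

Let the root \<open>c\<close> be a vertex at which \<open>x\<close> is largest. Each bridge has one end that it
separates from the root, its lower end. Distinct bridges have distinct lower ends
(\<open>mutually_below_imp_eq\<close>), so with \<open>p\<close> bridges there are \<open>p\<close> lower ends, and the root is none of
them. In \<open>H\<close> the lower ends are pendant vertices at \<open>c\<close> and the other vertices form a clique, so
\<open>H\<close> is \<open>complete_pendant (n - p) p\<close>. The edges of \<open>G\<close> are mapped to edges of \<open>H\<close> as follows: a bridge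
with lower end \<open>t\<close> goes to \<open>{t, c}\<close>, and in any other edge an end that is a lower end is replaced by
\<open>c\<close>. This map is injective (\<open>inj_on_reattach\<close>), because a component of \<open>G\<close> without
its bridges contains at most one vertex that is the root or a lower end, and it does not decrease
weights. Hence the spectral radius of \<open>H\<close> is at least that of \<open>G\<close>.

Moreover \<open>H\<close> has exactly \<open>p\<close> cut edges, since its clique cannot have two vertices
(\<open>card_clique_ne_2\<close>). By the maximality of \<open>G\<close> all inequalities are equalities. So \<open>x\<close> maximises the
form of \<open>H\<close> too and is an eigenvector of its Harary matrix, and the eigenvector equations of \<open>H\<close>
show that \<open>x\<close> is strictly largest at the root
(\<open>pendant_clique_eigenvector_root_maximal\<close>). An edge that is moved would therefore gain weight; so
no edge is moved, and \<open>G = H\<close> (\<open>arc_weight_eq_imp_arcs_eq\<close>).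
\<close>

section \<open>Quadratic forms and the spectral radius\<close>

definition quad_form :: "'a set \<Rightarrow> ('a \<Rightarrow> 'a \<Rightarrow> real) \<Rightarrow> ('a \<Rightarrow> real) \<Rightarrow> real" where
  "quad_form V k x = (\<Sum>u\<in>V. \<Sum>v\<in>V. k u v * x u * x v)"

text \<open>
The unit sphere of the functions on \<open>V\<close> is compact and the form is continuous and
homogeneous of degree two, so a maximum over the sphere bounds the form everywhere. Outside \<open>V\<close>
the functions of the compact set are fixed to be zero, which makes compactness an instance of
Tychonoff's theorem in the product topology.
\<close>

lemma quad_form_maximum_exists:
  assumes "finite V" "V \<noteq> {}"
  obtains x where "(\<Sum>v\<in>V. (x v)\<^sup>2) = 1"
    "\<And>y. quad_form V k y \<le> quad_form V k x * (\<Sum>v\<in>V. (y v)\<^sup>2)"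
proof -
  define B where "B = PiE UNIV (\<lambda>v. if v \<in> V then {-1..1::real} else {0})"
  define S where "S = B \<inter> {x. (\<Sum>v\<in>V. (x v)\<^sup>2) = 1}"
  have coord [continuous_intros]: "continuous_on A (\<lambda>x::'a \<Rightarrow> real. x v)" for v A
    by (rule continuous_on_subset[OF continuous_on_product_coordinates]) simp
  have "compact B"
  proof -
    have "compactin (product_topology (\<lambda>_. euclidean) UNIV) B"
      unfolding B_def by (subst compactin_PiE) auto
    then show ?thesis
      by (simp add: euclidean_product_topology)
  qed
  moreover have "closed {x::'a \<Rightarrow> real. (\<Sum>v\<in>V. (x v)\<^sup>2) = 1}"
    by (intro closed_Collect_eq continuous_intros)
  ultimately have "compact S"
    unfolding S_def by (rule compact_Int_closed)
  have in_S: "(\<lambda>v. if v \<in> V then z v else 0) \<in> S" if "(\<Sum>v\<in>V. (z v)\<^sup>2) = 1" for z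
  proof -
    have "\<bar>z v\<bar> \<le> 1" if "v \<in> V" for v
    proof -
      have "(z v)\<^sup>2 \<le> (\<Sum>v\<in>V. (z v)\<^sup>2)"
        by (rule member_le_sum) (use that assms in auto)
      then show ?thesis
        using \<open>_ = 1\<close> by (simp add: abs_square_le_1)
    qed
    then show ?thesis
      using that by (auto simp: S_def B_def abs_le_iff)
  qed
  obtain v0 where "v0 \<in> V" using assms by blast
  then have "(\<Sum>v\<in>V. (of_bool (v = v0) :: real)\<^sup>2) = 1"
    using assms by (simp add: of_bool_def if_distrib [of "\<lambda>x. x\<^sup>2"] cong: if_cong)
  then have "(\<lambda>v. if v \<in> V then of_bool (v = v0) else 0) \<in> S"
    by (rule in_S)
  then have "S \<noteq> {}"
    by blast
  moreover have "continuous_on S (quad_form V k)"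
    unfolding quad_form_def by (intro continuous_intros)
  ultimately obtain x where x: "x \<in> S" "\<And>y. y \<in> S \<Longrightarrow> quad_form V k y \<le> quad_form V k x"
    using continuous_attains_sup[OF \<open>compact S\<close>] by metis
  have "quad_form V k y \<le> quad_form V k x * (\<Sum>v\<in>V. (y v)\<^sup>2)" for y
  proof (cases "(\<Sum>v\<in>V. (y v)\<^sup>2) = 0")
    case True
    then have "\<And>v. v \<in> V \<Longrightarrow> y v = 0"
      using assms by (simp add: sum_nonneg_eq_0_iff)
    then show ?thesis
      by (simp add: quad_form_def)
  next
    case False
    define r where "r = (\<Sum>v\<in>V. (y v)\<^sup>2)"
    have "r > 0"
      using False by (simp add: r_def less_le sum_nonneg)
    define z where "z = (\<lambda>v. if v \<in> V then y v / sqrt r else 0)"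
    have "(\<Sum>v\<in>V. (y v / sqrt r)\<^sup>2) = 1"
      using \<open>r > 0\<close> by (simp add: power_divide flip: sum_divide_distrib r_def)
    then have "z \<in> S"
      unfolding z_def by (rule in_S)
    moreover have "quad_form V k z = quad_form V k y / r"
      using \<open>r > 0\<close> by (simp add: quad_form_def z_def sum_divide_distrib)
    ultimately show ?thesis
      using x(2)[of z] \<open>r > 0\<close> by (simp add: field_simps r_def)
  qed
  with x(1) show ?thesis
    using that[of x] by (simp add: S_def)
qed

text \<open>
Taking absolute values does not change the norm and does not decrease the form of a nonnegative
kernel.
\<close>

lemma quad_form_nonneg_maximum_exists:
  assumes "finite V" "V \<noteq> {}" and nonneg: "\<And>u v. u \<in> V \<Longrightarrow> v \<in> V \<Longrightarrow> k u v \<ge> 0"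
  obtains x where "\<And>v. x v \<ge> 0" "(\<Sum>v\<in>V. (x v)\<^sup>2) = 1"
    "\<And>y. quad_form V k y \<le> quad_form V k x * (\<Sum>v\<in>V. (y v)\<^sup>2)"
proof -
  obtain x where x: "(\<Sum>v\<in>V. (x v)\<^sup>2) = 1"
    "\<And>y. quad_form V k y \<le> quad_form V k x * (\<Sum>v\<in>V. (y v)\<^sup>2)"
    using quad_form_maximum_exists[OF assms(1,2)] by blast
  have le: "quad_form V k x \<le> quad_form V k (\<lambda>v. \<bar>x v\<bar>)"
    unfolding quad_form_def mult.assoc
    by (intro sum_mono mult_left_mono nonneg) (simp_all flip: abs_mult)
  have "quad_form V k y \<le> quad_form V k (\<lambda>v. \<bar>x v\<bar>) * (\<Sum>v\<in>V. (y v)\<^sup>2)" for y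
    by (rule order_trans[OF x(2) mult_right_mono]) (simp_all add: le sum_nonneg)
  with x(1) show ?thesis
    by (intro that[of "\<lambda>v. \<bar>x v\<bar>"]) auto
qed

text \<open>
First-order condition: moving the maximiser by \<open>t\<close> in the direction of \<open>u\<close> changes
\<open>quad_form V k y - M * (\<Sum>v\<in>V. (y v)\<^sup>2)\<close> from \<open>0\<close> to \<open>2 * t * g - t\<^sup>2 * q\<close>, where \<open>g\<close> is the
defect of the eigenvector equation at \<open>u\<close>; this can stay nonpositive for all \<open>t\<close> only if
\<open>g = 0\<close>.
\<close>

lemma quad_form_maximiser_eigenvector:
  assumes "finite V" and sym: "\<And>u v. k u v = k v u"
    and bound: "\<And>y. quad_form V k y \<le> M * (\<Sum>v\<in>V. (y v)\<^sup>2)"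
    and attained: "quad_form V k x = M * (\<Sum>v\<in>V. (x v)\<^sup>2)"
    and "u \<in> V"
  shows "(\<Sum>v\<in>V. k u v * x v) = M * x u"
proof -
  define g where "g = (\<Sum>v\<in>V. k u v * x v) - M * x u"
  define q where "q = M - k u u"
  have ineq: "2 * t * g \<le> t\<^sup>2 * q" for t
  proof -
    define d where "d = (\<lambda>v. if v = u then t else 0)"
    have d_sum: "(\<Sum>v\<in>V. f v * d v) = f u * t" for f
      using \<open>finite V\<close> \<open>u \<in> V\<close> by (simp add: d_def if_distrib[of "\<lambda>z. _ * z"] cong: if_cong)
    have "quad_form V k (\<lambda>v. x v + d v) = quad_form V k x
        + (\<Sum>a\<in>V. (\<Sum>b\<in>V. k a b * x b) * d a) + (\<Sum>a\<in>V. (\<Sum>b\<in>V. (k a b * x a) * d b))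
        + (\<Sum>a\<in>V. (\<Sum>b\<in>V. k a b * d b) * d a)"
      by (simp add: quad_form_def algebra_simps sum.distrib sum_distrib_left)
    also have "\<dots> = quad_form V k x + 2 * t * (\<Sum>v\<in>V. k u v * x v) + t\<^sup>2 * k u u"
      unfolding d_sum using sum.cong[OF refl, of V "\<lambda>v. k v u * x v" "\<lambda>v. k u v * x v"]
      by (simp add: sym power2_eq_square flip: sum_distrib_right)
    finally have 1: "quad_form V k (\<lambda>v. x v + d v)
        = quad_form V k x + 2 * t * (\<Sum>v\<in>V. k u v * x v) + t\<^sup>2 * k u u" .
    have "(\<Sum>v\<in>V. (x v + d v)\<^sup>2) = (\<Sum>v\<in>V. (x v)\<^sup>2) + 2 * (\<Sum>v\<in>V. x v * d v) + (\<Sum>v\<in>V. d v * d v)"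
      by (simp add: power2_eq_square algebra_simps sum.distrib sum_distrib_left)
    also have "\<dots> = (\<Sum>v\<in>V. (x v)\<^sup>2) + 2 * t * x u + t\<^sup>2"
      unfolding d_sum by (simp add: d_def power2_eq_square)
    finally show ?thesis
      using bound[of "\<lambda>v. x v + d v"] attained 1 by (simp add: g_def q_def algebra_simps)
  qed
  \<comment> \<open>small enough for the linear term to dominate\<close>
  define t where "t = g / (\<bar>q\<bar> + 1)"
  have tq: "t * (\<bar>q\<bar> + 1) = g"
    unfolding t_def by (simp add: add_nonneg_eq_0_iff)
  have "2 * t * g \<le> t\<^sup>2 * (\<bar>q\<bar> + 1)"
    by (rule order_trans[OF ineq mult_left_mono]) auto
  also have "\<dots> = t * g"
    by (simp add: power2_eq_square mult.assoc tq)
  finally have "t * g \<le> 0"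
    by (simp add: mult_ac)
  then have "g * g / (\<bar>q\<bar> + 1) \<le> 0"
    by (simp add: t_def)
  moreover have "\<bar>q\<bar> + 1 > 0" by simp
  ultimately have "g * g \<le> 0"
    by (simp add: pos_divide_le_eq)
  then have "g = 0"
    by (auto simp: mult_le_0_iff)
  then show ?thesis
    by (simp add: g_def)
qed

text \<open>
The maximum \<open>M\<close> is an eigenvalue by the first-order condition. Conversely, if \<open>w\<close> is a complex
eigenvector for \<open>l\<close> and \<open>y\<close> consists of the moduli of its entries, then
\<open>norm l * y u \<le> (\<Sum>v\<in>V. k u v * y v)\<close> by the triangle inequality, and pairing this with \<open>y\<close> gives
\<open>norm l \<le> M\<close>.
\<close>

lemma spectral_radius_eq_quad_form_maximum:
  fixes k :: "'a \<Rightarrow> 'a \<Rightarrow> real"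
  assumes vs: "distinct vs" "set vs = V" and "V \<noteq> {}"
    and sym: "\<And>u v. k u v = k v u" and nonneg: "\<And>u v. u \<in> V \<Longrightarrow> v \<in> V \<Longrightarrow> k u v \<ge> 0"
    and x: "\<And>v. x v \<ge> 0" "(\<Sum>v\<in>V. (x v)\<^sup>2) = 1"
    and max: "\<And>y. quad_form V k y \<le> quad_form V k x * (\<Sum>v\<in>V. (y v)\<^sup>2)"
  shows "spectral_radius (map_mat complex_of_real
    (mat (length vs) (length vs) (\<lambda>(i, j). k (vs ! i) (vs ! j)))) = quad_form V k x"
proof -
  define n where "n = length vs"
  define A where "A = map_mat complex_of_real (mat n n (\<lambda>(i, j). k (vs ! i) (vs ! j)))"
  define M where "M = quad_form V k x"
  have A: "A \<in> carrier_mat n n"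
    by (simp add: A_def)
  have "finite V" using vs by auto
  have nth_V: "vs ! i \<in> V" if "i < n" for i
    using that vs(2) by (auto simp: n_def)
  have bij: "bij_betw ((!) vs) {0..<n} V"
    using vs bij_betw_nth[of vs "{0..<n}" V] by (auto simp: n_def lessThan_atLeast0)
  have sum_nth: "(\<Sum>i\<in>{0..<n}. f (vs ! i)) = (\<Sum>v\<in>V. f v)" for f :: "'a \<Rightarrow> 'b::comm_monoid_add"
    by (rule sum.reindex_bij_betw[OF bij])
  have "n > 0"
    using \<open>V \<noteq> {}\<close> vs(2) by (auto simp: n_def)
  have "M \<ge> 0"
    unfolding M_def quad_form_def by (intro sum_nonneg mult_nonneg_nonneg nonneg x)
  have A_mult: "(A *\<^sub>v z) $ i = (\<Sum>j\<in>{0..<n}. of_real (k (vs ! i) (vs ! j)) * z $ j)"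
    if "i < n" "z \<in> carrier_vec n" for z i
    using that by (simp add: A_def scalar_prod_def)
  define z where "z = vec n (\<lambda>i. complex_of_real (x (vs ! i)))"
  have "A *\<^sub>v z = of_real M \<cdot>\<^sub>v z"
  proof (rule eq_vecI)
    fix i assume "i < dim_vec (of_real M \<cdot>\<^sub>v z)"
    then have i: "i < n" by (simp add: z_def)
    have "(A *\<^sub>v z) $ i = (\<Sum>j\<in>{0..<n}. of_real (k (vs ! i) (vs ! j) * x (vs ! j)))"
      using i by (subst A_mult) (auto simp: z_def)
    also have "\<dots> = of_real (\<Sum>v\<in>V. k (vs ! i) v * x v)"
      by (subst sum_nth) simp
    also have "(\<Sum>v\<in>V. k (vs ! i) v * x v) = M * x (vs ! i)"
      by (rule quad_form_maximiser_eigenvector[OF \<open>finite V\<close> sym])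
         (use max x nth_V[OF i] in \<open>auto simp: M_def\<close>)
    finally show "(A *\<^sub>v z) $ i = (of_real M \<cdot>\<^sub>v z) $ i"
      using i by (simp add: z_def)
  qed (simp add: A_def z_def)
  moreover have "z \<noteq> 0\<^sub>v n"
  proof
    assume "z = 0\<^sub>v n"
    then have "x (vs ! i) = 0" if "i < n" for i
      using that unfolding z_def by (metis index_vec index_zero_vec(1) of_real_eq_0_iff)
    then have "(\<Sum>v\<in>V. (x v)\<^sup>2) = 0"
      by (subst sum_nth[symmetric]) simp
    with x show False by simp
  qed
  ultimately have "eigenvalue A (of_real M)"
    unfolding eigenvalue_def eigenvector_def
    by (intro exI[of _ z]) (simp add: z_def A_def)
  then have "M \<in> norm ` spectrum A"
    using \<open>M \<ge> 0\<close> by (auto simp: spectrum_def image_iff intro!: exI[of _ "complex_of_real M"])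
  then have "M \<le> spectral_radius A"
    by (rule spectral_radius_mem_max(2)[OF A \<open>n > 0\<close>])
  moreover have "spectral_radius A \<le> M"
  proof -
    obtain l where l: "eigenvalue A l" "spectral_radius A = norm l"
      using spectral_radius_mem_max(1)[OF A \<open>n > 0\<close>] by (auto simp: spectrum_def)
    then obtain w where w: "w \<in> carrier_vec n" "w \<noteq> 0\<^sub>v n" "A *\<^sub>v w = l \<cdot>\<^sub>v w"
      using A by (auto simp: eigenvalue_def eigenvector_def)
    define y where "y = (\<lambda>v. norm (w $ the_inv_into {0..<n} ((!) vs) v))"
    have y_nth: "y (vs ! i) = norm (w $ i)" if "i < n" for i
      using that bij by (simp add: y_def bij_betw_def the_inv_into_f_f)
    have y_ineq: "norm l * y u \<le> (\<Sum>v\<in>V. k u v * y v)" if u: "u \<in> V" for u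
    proof -
      obtain i where i: "i < n" "u = vs ! i"
        using u vs(2) by (auto simp: in_set_conv_nth n_def)
      have "norm l * y u = norm ((A *\<^sub>v w) $ i)"
        using i w(1) unfolding w(3) by (simp add: y_nth norm_mult)
      also have "\<dots> \<le> (\<Sum>j\<in>{0..<n}. norm (of_real (k u (vs ! j)) * w $ j))"
        unfolding A_mult[OF i(1) w(1)] i(2)[symmetric] by (rule norm_sum)
      also have "\<dots> = (\<Sum>j\<in>{0..<n}. k u (vs ! j) * y (vs ! j))"
        using u nth_V by (intro sum.cong refl) (simp add: norm_mult y_nth nonneg)
      finally show ?thesis
        by (simp only: sum_nth[of "\<lambda>v. k u v * y v"])
    qed
    have "norm l * (\<Sum>u\<in>V. (y u)\<^sup>2) = (\<Sum>u\<in>V. y u * (norm l * y u))"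
      by (simp add: sum_distrib_left power2_eq_square mult_ac)
    also have "\<dots> \<le> (\<Sum>u\<in>V. y u * (\<Sum>v\<in>V. k u v * y v))"
      by (intro sum_mono mult_left_mono y_ineq) (auto simp: y_def)
    also have "\<dots> = quad_form V k y"
      by (simp add: quad_form_def sum_distrib_left mult_ac)
    also have "\<dots> \<le> M * (\<Sum>u\<in>V. (y u)\<^sup>2)"
      unfolding M_def by (rule max)
    finally have "norm l * (\<Sum>u\<in>V. (y u)\<^sup>2) \<le> M * (\<Sum>u\<in>V. (y u)\<^sup>2)" .
    moreover have "(\<Sum>u\<in>V. (y u)\<^sup>2) > 0"
    proof -
      obtain i where i: "i < n" "w $ i \<noteq> 0"
        using w(1,2) by (metis carrier_vecD eq_vecI index_zero_vec)
      then have "(y (vs ! i))\<^sup>2 > 0"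
        by (simp add: y_nth)
      also have "(y (vs ! i))\<^sup>2 \<le> (\<Sum>u\<in>V. (y u)\<^sup>2)"
        by (rule member_le_sum) (use nth_V i \<open>finite V\<close> in auto)
      finally show ?thesis .
    qed
    ultimately show ?thesis
      using l(2) by simp
  qed
  ultimately show ?thesis
    unfolding A_def M_def n_def by simp
qed

section \<open>Bridges of a connected graph with a root\<close>

text \<open>
A connected simple graph given by its vertices and its symmetric set of arcs. The root will be a
vertex at which the maximising vector is largest; all bridges are oriented away from it.
\<close>

locale rooted_graph =
  fixes V :: "'a set" and E :: "'a rel" and c :: 'a
  assumes finite_V: "finite V" and E_subset: "E \<subseteq> V \<times> V" and irrefl_E: "(u, u) \<notin> E"
    and sym_E: "(u, v) \<in> E \<Longrightarrow> (v, u) \<in> E"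
    and root_in_V: "c \<in> V" and connected_E: "v \<in> V \<Longrightarrow> (c, v) \<in> E\<^sup>*"
begin

definition del :: "'a set \<Rightarrow> 'a rel" where
  "del e = {(u, v) \<in> E. {u, v} \<noteq> e}"

definition bridges :: "'a set set" where
  "bridges = {{u, v} | u v. (u, v) \<in> E \<and> (u, v) \<notin> (del {u, v})\<^sup>*}"

text \<open>
For a bridge this is the component of the graph without \<open>e\<close> that does not contain the root.
\<close>

definition below :: "'a set \<Rightarrow> 'a set" where
  "below e = {v. (c, v) \<notin> (del e)\<^sup>*}"

definition lower_end :: "'a set \<Rightarrow> 'a" where
  "lower_end e = (THE t. t \<in> e \<and> t \<in> below e)"

definition lower_ends :: "'a set" where
  "lower_ends = lower_end ` bridges"

lemma sym_rtrancl_del: "(u, v) \<in> (del e)\<^sup>* \<Longrightarrow> (v, u) \<in> (del e)\<^sup>*"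
  by (rule symD[OF sym_rtrancl]) (auto simp: sym_def del_def insert_commute intro: sym_E)

lemma root_not_below: "c \<notin> below e"
  by (simp add: below_def)

lemma below_adjacent:
  assumes "(u, v) \<in> E" "{u, v} \<noteq> e"
  shows "u \<in> below e \<longleftrightarrow> v \<in> below e"
proof -
  have "(u, v) \<in> del e" "(v, u) \<in> del e"
    using assms by (auto simp: del_def insert_commute intro: sym_E)
  then show ?thesis
    unfolding below_def by (auto intro: rtrancl_into_rtrancl)
qed

text \<open>
A walk from the root that does not survive the deletion of \<open>e\<close> reaches an end of \<open>e\<close> before
using it; so a bridge has an end on the side of the root.
\<close>

lemma reachable_or_meets_deleted:
  assumes "(c, w) \<in> E\<^sup>*"
  shows "w \<notin> below e \<or> (\<exists>z\<in>e. z \<notin> below e)"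
  using assms
proof (induction rule: rtrancl_induct)
  case base
  then show ?case by (simp add: root_not_below)
next
  case (step y z)
  then show ?case
    using below_adjacent[of y z e] by blast
qed

lemma bridge_cases:
  assumes "e \<in> bridges"
  obtains s where "{s, lower_end e} = e" "(s, lower_end e) \<in> E" "s \<notin> below e" "lower_end e \<in> below e"
proof -
  obtain u v where e: "e = {u, v}" "(u, v) \<in> E" "(u, v) \<notin> (del e)\<^sup>*"
    using assms unfolding bridges_def by blast
  have "u \<in> below e \<or> v \<in> below e"
    using e(3) sym_rtrancl_del[of c u e] unfolding below_def by (auto dest: rtrancl_trans)
  moreover have "u \<notin> below e \<or> v \<notin> below e"
    using reachable_or_meets_deleted[OF connected_E, of u e] e E_subset by auto
  ultimately consider "u \<in> below e" "v \<notin> below e" | "v \<in> below e" "u \<notin> below e"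
    by blast
  then show ?thesis
  proof cases
    case 1
    then have "lower_end e = u"
      unfolding lower_end_def using e by (intro the_equality) auto
    with 1 e show ?thesis
      by (intro that[of v]) (auto intro: sym_E)
  next
    case 2
    then have "lower_end e = v"
      unfolding lower_end_def using e by (intro the_equality) auto
    with 2 e show ?thesis
      by (intro that[of u]) auto
  qed
qed

lemma lower_end_below: "e \<in> bridges \<Longrightarrow> lower_end e \<in> below e"
  by (erule bridge_cases)

lemma lower_end_in: "e \<in> bridges \<Longrightarrow> lower_end e \<in> e"
  by (metis bridge_cases insertCI)

lemma root_not_lower_end: "c \<notin> lower_ends"
  unfolding lower_ends_def using lower_end_below root_not_below by (metis imageE)

lemma lower_ends_subset: "lower_ends \<subseteq> V"
  using E_subset by (auto simp: lower_ends_def elim!: bridge_cases)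

text \<open>
Distinct bridges are nested or separated, never each below the other. If each lower end were
below the other bridge, a walk from the root to the upper end of \<open>f\<close> that avoids \<open>f\<close> would stay
outside \<open>below f\<close>, hence away from the lower end of \<open>e\<close> and from \<open>e\<close> itself. Followed by \<open>f\<close>, it
would reach the lower end of \<open>f\<close> without \<open>e\<close>.
\<close>

lemma mutually_below_imp_eq:
  assumes "e \<in> bridges" "f \<in> bridges" "lower_end e \<in> below f" "lower_end f \<in> below e"
  shows "e = f"
proof (rule ccontr)
  assume "e \<noteq> f"
  obtain s where s: "{s, lower_end f} = f" "(s, lower_end f) \<in> E" "s \<notin> below f"
    using bridge_cases[OF assms(2)] by metis
  have "w \<notin> below e" if "(c, w) \<in> (del f)\<^sup>*" for w
    using that
  proof (induction rule: rtrancl_induct)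
    case base
    then show ?case by (rule root_not_below)
  next
    case (step y z)
    then have "z \<notin> below f" "y \<notin> below f" "(y, z) \<in> E"
      by (auto simp: below_def del_def intro: rtrancl_into_rtrancl)
    moreover from this have "{y, z} \<noteq> e"
      using assms(3) lower_end_in[OF assms(1)] by auto
    ultimately show ?case
      using below_adjacent[of y z e] step.IH by blast
  qed
  then have "s \<notin> below e"
    using s(3) by (simp add: below_def)
  then show False
    using below_adjacent[OF s(2), of e] s(1) \<open>e \<noteq> f\<close> assms(4) by simp
qed

lemma inj_on_lower_end: "inj_on lower_end bridges"
  by (rule inj_onI) (metis mutually_below_imp_eq lower_end_below)

lemma card_lower_ends: "card lower_ends = card bridges"
  unfolding lower_ends_def by (rule card_image[OF inj_on_lower_end])

text \<open>
This relation contains the equivalence "joined by a walk without bridges" and is easier to handle,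
since it needs no walks.
\<close>

definition same_side :: "'a \<Rightarrow> 'a \<Rightarrow> bool" where
  "same_side u v \<longleftrightarrow> (\<forall>e\<in>bridges. u \<in> below e \<longleftrightarrow> v \<in> below e)"

lemma same_side_adjacent: "(u, v) \<in> E \<Longrightarrow> {u, v} \<notin> bridges \<Longrightarrow> same_side u v"
  unfolding same_side_def using below_adjacent by metis

lemma same_side_sym: "same_side u v \<Longrightarrow> same_side v u"
  and same_side_trans: "same_side u v \<Longrightarrow> same_side v w \<Longrightarrow> same_side u w"
  by (auto simp: same_side_def)

text \<open>
A component of the graph without bridges has a single vertex through which it is entered from the
root: the root itself or the lower end of a bridge.
\<close>

lemma same_side_unique:
  assumes "same_side u v" "u \<in> insert c lower_ends" "v \<in> insert c lower_ends"
  shows "u = v"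
proof -
  have *: "u = v" if "same_side u v" "e \<in> bridges" "u = lower_end e" "v \<in> insert c lower_ends" for u v e
  proof -
    have v: "v \<in> below e"
      using that lower_end_below[of e] by (simp add: same_side_def)
    with that(4) root_not_below obtain f where f: "f \<in> bridges" "v = lower_end f"
      unfolding lower_ends_def by auto
    have "u \<in> below f"
      using that(1) f lower_end_below[of f] by (simp add: same_side_def)
    then have "e = f"
      using mutually_below_imp_eq[OF that(2) f(1)] v f(2) that(3) by simp
    then show ?thesis
      using f(2) that(3) by simp
  qed
  show ?thesis
  proof (cases "u = c")
    case False
    then obtain e where "e \<in> bridges" "u = lower_end e"
      using assms(2) by (auto simp: lower_ends_def)
    then show ?thesis
      using * assms(1,3) by blast
  next
    case True
    show ?thesis
    proof (rule ccontr)
      assume "u \<noteq> v"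
      then obtain e where "e \<in> bridges" "v = lower_end e"
        using assms(3) True by (auto simp: lower_ends_def)
      then show False
        using *[of v u e] same_side_sym[OF assms(1)] assms(2) \<open>u \<noteq> v\<close> by blast
    qed
  qed
qed

lemma bridge_ends:
  assumes "{a, b} \<in> bridges"
  obtains "lower_end {a, b} = a" "b \<noteq> a" "a \<in> lower_ends" | "lower_end {a, b} = b" "a \<noteq> b" "b \<in> lower_ends"
proof -
  define t where "t = lower_end {a, b}"
  obtain s where s: "{s, t} = {a, b}" "s \<notin> below {a, b}" "t \<in> below {a, b}"
    using bridge_cases[OF assms] unfolding t_def by metis
  then have "s \<noteq> t" by metis
  moreover have "t \<in> lower_ends"
    using assms by (simp add: lower_ends_def t_def)
  moreover from s(1) have "s = a \<and> t = b \<or> s = b \<and> t = a"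
    by (auto simp: doubleton_eq_iff)
  ultimately show ?thesis
    using that unfolding t_def[symmetric] by blast
qed

section \<open>Shifting edges towards the root\<close>

text \<open>
The arcs of the extremal graph on the same vertices: the lower ends of the bridges become pendant
vertices at the root, all other vertices form a clique.
\<close>

definition pendant_clique_arcs :: "'a rel" where
  "pendant_clique_arcs = {(u, v) \<in> V \<times> V. u \<noteq> v \<and> (u = c \<or> v = c \<or> u \<notin> lower_ends \<and> v \<notin> lower_ends)}"

definition to_root :: "'a \<Rightarrow> 'a" where
  "to_root v = (if v \<in> lower_ends then c else v)"

text \<open>
A bridge is turned into the pendant edge at its lower end. Every other edge lies in a component of
the graph without bridges; if it meets the vertex through which this component is entered,
that vertex is replaced by the root. Only one end of such an edge can be replaced.
\<close>

definition reattach :: "'a \<times> 'a \<Rightarrow> 'a \<times> 'a" where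
  "reattach = (\<lambda>(a, b). if {a, b} \<in> bridges
     then if lower_end {a, b} = a then (a, c) else (c, b)
     else (to_root a, to_root b))"

lemma to_root_not_lower_end: "to_root v \<notin> lower_ends"
  by (simp add: to_root_def root_not_lower_end)

lemma to_root_eq_imp: "to_root u = to_root v \<Longrightarrow> u \<noteq> v \<Longrightarrow> u \<in> insert c lower_ends \<and> v \<in> insert c lower_ends"
  by (auto simp: to_root_def split: if_splits)

lemma reattach_in:
  assumes "(a, b) \<in> E"
  shows "reattach (a, b) \<in> pendant_clique_arcs"
proof (cases "{a, b} \<in> bridges")
  case True
  then show ?thesis
    by (cases rule: bridge_ends)
      (use True assms E_subset root_in_V root_not_lower_end in \<open>auto simp: reattach_def pendant_clique_arcs_def\<close>)
next
  case False
  have "a \<noteq> b" using assms irrefl_E by auto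
  have "to_root a \<noteq> to_root b"
    using same_side_unique[OF same_side_adjacent[OF assms False]] to_root_eq_imp[of a b] \<open>a \<noteq> b\<close>
    by metis
  then show ?thesis
    using False assms E_subset root_in_V to_root_not_lower_end[of a] to_root_not_lower_end[of b]
    by (auto simp: reattach_def pendant_clique_arcs_def to_root_def)
qed

text \<open>
An image that contains a lower end determines the bridge, because distinct bridges have distinct
lower ends. Two other edges with the same image can differ at an end only if both versions of this
end are sent to the root. Each edge has at most one such end, so the edges share the other end and
lie in the same component without bridges, where only one vertex is sent to the root.
\<close>

lemma inj_on_reattach: "inj_on reattach E"
proof (rule inj_onI, clarify)
  fix a b a' b'
  assume E: "(a, b) \<in> E" "(a', b') \<in> E" and eq: "reattach (a, b) = reattach (a', b')"
  consider "{a, b} \<in> bridges" "{a', b'} \<in> bridges" | "{a, b} \<in> bridges" "{a', b'} \<notin> bridges"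
    | "{a, b} \<notin> bridges" "{a', b'} \<in> bridges" | "{a, b} \<notin> bridges" "{a', b'} \<notin> bridges"
    by blast
  then show "a = a' \<and> b = b'"
  proof cases
    case 1
    have *: "{a, b} = {a', b'}" if "lower_end {a, b} = lower_end {a', b'}"
      using inj_on_lower_end 1 that by (meson inj_onD)
    show ?thesis
      using 1(1)
    proof (cases rule: bridge_ends)
      case t: 1
      from 1(2) show ?thesis
        by (cases rule: bridge_ends)
          (use eq t 1 * root_not_lower_end in \<open>auto simp: reattach_def doubleton_eq_iff split: if_splits\<close>)
    next
      case t: 2
      from 1(2) show ?thesis
        by (cases rule: bridge_ends)
          (use eq t 1 * root_not_lower_end in \<open>auto simp: reattach_def doubleton_eq_iff split: if_splits\<close>)
    qed
  next
    case 2
    have False using 2(1)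
      by (cases rule: bridge_ends)
        (use eq 2 to_root_not_lower_end[of a'] to_root_not_lower_end[of b'] in \<open>auto simp: reattach_def split: if_splits\<close>)
    then show ?thesis ..
  next
    case 3
    have False using 3(2)
      by (cases rule: bridge_ends)
        (use eq 3 to_root_not_lower_end[of a] to_root_not_lower_end[of b] in \<open>auto simp: reattach_def split: if_splits\<close>)
    then show ?thesis ..
  next
    case 4
    have to_root: "to_root a = to_root a'" "to_root b = to_root b'"
      using eq 4 by (auto simp: reattach_def)
    have sides: "same_side a b" "same_side a' b'"
      using same_side_adjacent E 4 by auto
    have ne: "a \<noteq> b" "a' \<noteq> b'" using E irrefl_E by auto
    show ?thesis
    proof (rule ccontr)
      assume "\<not> (a = a' \<and> b = b')"
      then consider "a \<noteq> a'" "b = b'" | "a = a'" "b \<noteq> b'" | "a \<noteq> a'" "b \<noteq> b'"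
        by blast
      then show False
      proof cases
        case 1
        then have "same_side a a'"
          using sides same_side_trans[OF _ same_side_sym] by blast
        then show False
          using to_root_eq_imp[OF to_root(1)] 1 same_side_unique by blast
      next
        case 2
        then have "same_side b b'"
          using sides same_side_trans[OF same_side_sym] by blast
        then show False
          using to_root_eq_imp[OF to_root(2)] 2 same_side_unique by blast
      next
        case 3
        then show False
          using to_root_eq_imp[OF to_root(1)] to_root_eq_imp[OF to_root(2)] same_side_unique[OF sides(1)] ne by blast
      qed
    qed
  qed
qed

lemma finite_E: "finite E"
  by (rule finite_subset[OF E_subset]) (simp add: finite_V)

lemma finite_pendant_clique_arcs: "finite pendant_clique_arcs"
  by (rule finite_subset[of _ "V \<times> V"]) (auto simp: pendant_clique_arcs_def finite_V)

text \<open>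
Shifting an edge replaces one of its ends by the root, where the weight is largest, or keeps both.
\<close>

lemma arc_weight_reattach:
  fixes x :: "'a \<Rightarrow> real"
  assumes nonneg: "\<And>v. x v \<ge> 0" and max: "\<And>v. v \<in> V \<Longrightarrow> x v \<le> x c" and "(a, b) \<in> E"
  shows "x a * x b \<le> x (fst (reattach (a, b))) * x (snd (reattach (a, b)))"
proof -
  have "x v \<le> x (to_root v)" if "v \<in> V" for v
    using max[OF that] by (simp add: to_root_def)
  then show ?thesis
    using assms(3) E_subset max nonneg
    by (auto simp: reattach_def intro!: mult_mono)
qed

lemma arc_weight_le:
  fixes x :: "'a \<Rightarrow> real"
  assumes "\<And>v. x v \<ge> 0" and "\<And>v. v \<in> V \<Longrightarrow> x v \<le> x c"
  shows "(\<Sum>(a, b)\<in>E. x a * x b) \<le> (\<Sum>(a, b)\<in>pendant_clique_arcs. x a * x b)"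
proof -
  have "(\<Sum>(a, b)\<in>E. x a * x b) \<le> (\<Sum>(a, b)\<in>E. x (fst (reattach (a, b))) * x (snd (reattach (a, b))))"
    using arc_weight_reattach[where x = x, OF assms] by (intro sum_mono) auto
  also have "\<dots> = (\<Sum>(a, b)\<in>reattach ` E. x a * x b)"
    by (simp add: sum.reindex[OF inj_on_reattach] case_prod_unfold)
  also have "\<dots> \<le> (\<Sum>(a, b)\<in>pendant_clique_arcs. x a * x b)"
    using reattach_in assms(1) finite_pendant_clique_arcs by (intro sum_mono2) auto
  finally show ?thesis .
qed

text \<open>
If the root is the only heaviest vertex, every edge that is really moved gains weight. In the case
of equality no edge is moved, and the images, which are then the edges themselves, exhaust the
extremal graph. The heaviest vertex need be unique only if there is a third vertex and a
bridge, because an edge that is moved consists of two vertices other than the root.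
\<close>

lemma arc_weight_eq_imp_arcs_eq:
  fixes x :: "'a \<Rightarrow> real"
  assumes pos: "\<And>v. x v \<ge> 0" "\<And>v. v \<in> V \<Longrightarrow> x v > 0" and max: "\<And>v. v \<in> V \<Longrightarrow> x v \<le> x c"
    and strict: "\<And>v w. v \<in> V \<Longrightarrow> w \<in> V \<Longrightarrow> distinct [c, v, w] \<Longrightarrow> lower_ends \<noteq> {} \<Longrightarrow> x v < x c"
    and eq: "(\<Sum>(a, b)\<in>E. x a * x b) = (\<Sum>(a, b)\<in>pendant_clique_arcs. x a * x b)"
  shows "E = pendant_clique_arcs"
proof -
  define w where "w = (\<lambda>(a, b). x a * x b)"
  have w_le: "w p \<le> w (reattach p)" if "p \<in> E" for p
    using that arc_weight_reattach[where x = x, OF pos(1) max] by (cases p) (auto simp: w_def case_prod_unfold)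
  have sub: "reattach ` E \<subseteq> pendant_clique_arcs"
    using reattach_in by auto
  have 1: "(\<Sum>p\<in>E. w p) \<le> (\<Sum>p\<in>E. w (reattach p))"
    by (intro sum_mono w_le)
  have 2: "(\<Sum>p\<in>E. w (reattach p)) = (\<Sum>p\<in>reattach ` E. w p)"
    by (simp add: sum.reindex[OF inj_on_reattach])
  have 3: "(\<Sum>p\<in>pendant_clique_arcs. w p)
      = (\<Sum>p\<in>reattach ` E. w p) + (\<Sum>p\<in>pendant_clique_arcs - reattach ` E. w p)"
    by (metis add.commute finite_pendant_clique_arcs sub sum.subset_diff)
  have w_pos: "w p > 0" if "p \<in> pendant_clique_arcs" for p
    using that pos(2) by (auto simp: w_def pendant_clique_arcs_def)
  have "(\<Sum>p\<in>pendant_clique_arcs - reattach ` E. w p) \<ge> 0"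
    by (intro sum_nonneg less_imp_le w_pos) auto
  with 1 2 3 eq have eq1: "(\<Sum>p\<in>E. w p) = (\<Sum>p\<in>E. w (reattach p))"
    and eq2: "(\<Sum>p\<in>pendant_clique_arcs - reattach ` E. w p) = 0"
    by (auto simp: w_def)
  have onto: "reattach ` E = pendant_clique_arcs"
  proof (rule ccontr)
    assume "reattach ` E \<noteq> pendant_clique_arcs"
    then have "(\<Sum>p\<in>pendant_clique_arcs - reattach ` E. w p) > 0"
      using sub finite_pendant_clique_arcs by (intro sum_pos w_pos) auto
    with eq2 show False by simp
  qed
  have w_eq: "w p = w (reattach p)" if "p \<in> E" for p
    using sum_mono_inv[OF eq1 w_le that finite_E] by simp
  have "reattach (a, b) = (a, b)" if ab: "(a, b) \<in> E" for a b
  proof -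
    have V: "a \<in> V" "b \<in> V" and ne: "a \<noteq> b" using ab E_subset irrefl_E by auto
    note weq = w_eq[OF ab]
    show ?thesis
    proof (cases "{a, b} \<in> bridges")
      case True
      then have lower_ends: "lower_ends \<noteq> {}" by (auto simp: lower_ends_def)
      from True show ?thesis
      proof (cases rule: bridge_ends)
        case 1
        then have "x b = x c"
          using weq True pos(2)[OF V(1)] by (simp add: reattach_def w_def)
        moreover have "a \<noteq> c" using 1(3) root_not_lower_end by auto
        ultimately have "b = c"
          using strict[OF V(2) V(1) _ lower_ends] ne by auto
        then show ?thesis
          using 1 True by (simp add: reattach_def)
      next
        case 2
        then have "x a = x c"
          using weq True pos(2)[OF V(2)] by (simp add: reattach_def w_def)
        moreover have "b \<noteq> c" using 2(3) root_not_lower_end by auto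
        ultimately have "a = c"
          using strict[OF V(1) V(2) _ lower_ends] ne by auto
        then show ?thesis
          using 2 True by (simp add: reattach_def)
      qed
    next
      case False
      note side = same_side_unique[OF same_side_adjacent[OF ab False]]
      have r: "reattach (a, b) = (to_root a, to_root b)"
        using False by (simp add: reattach_def)
      have "a \<notin> lower_ends"
      proof
        assume a: "a \<in> lower_ends"
        with side ne have "b \<notin> insert c lower_ends" by blast
        then have "x a < x c"
          using strict[OF V] a ne root_not_lower_end by auto
        moreover have "x a = x c"
          using weq a \<open>b \<notin> insert c lower_ends\<close> pos(2)[OF V(2)] by (simp add: r w_def to_root_def)
        ultimately show False by simp
      qed
      moreover have "b \<notin> lower_ends"
      proof
        assume b: "b \<in> lower_ends"
        with side ne have "a \<notin> insert c lower_ends" by blast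
        then have "x b < x c"
          using strict[OF V(2,1)] b ne root_not_lower_end by auto
        moreover have "x b = x c"
          using weq b \<open>a \<notin> insert c lower_ends\<close> pos(2)[OF V(1)] by (simp add: r w_def to_root_def)
        ultimately show False by simp
      qed
      ultimately show ?thesis by (simp add: r to_root_def)
    qed
  qed
  then have "reattach ` E = E" by force
  with onto show ?thesis by simp
qed

text \<open>
The walk is cut at its first arrival at \<open>u\<close>.
\<close>

lemma last_arc_avoiding:
  assumes "(a, u) \<in> R\<^sup>*" "a \<noteq> u"
  obtains w where "(w, u) \<in> R" "(a, w) \<in> {(y, z) \<in> R. y \<noteq> u \<and> z \<noteq> u}\<^sup>*"
proof -
  let ?R = "{(y, z) \<in> R. y \<noteq> u \<and> z \<noteq> u}"
  have "(y \<noteq> u \<and> (a, y) \<in> ?R\<^sup>*) \<or> (\<exists>w. (w, u) \<in> R \<and> (a, w) \<in> ?R\<^sup>*)" if "(a, y) \<in> R\<^sup>*" for y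
    using that
  proof (induction rule: rtrancl_induct)
    case base
    then show ?case using assms(2) by auto
  next
    case (step y z)
    show ?case
    proof (cases "z = u")
      case True
      with step show ?thesis by blast
    next
      case False
      with step have "(a, y) \<in> ?R\<^sup>* \<Longrightarrow> y \<noteq> u \<Longrightarrow> (a, z) \<in> ?R\<^sup>*"
        by (auto intro: rtrancl_into_rtrancl)
      with step.IH False show ?thesis by blast
    qed
  qed
  with assms that show ?thesis by blast
qed

text \<open>
With two clique vertices the extremal graph would be a star and its single clique edge would be a
further bridge, so the number of bridges would be wrong. This case cannot occur: a clique vertex
\<open>u\<close> other than the root is first entered from the root through an edge \<open>{w, u}\<close> that is not a
bridge, hence lies on a cycle, and the other edge \<open>{z, u}\<close> of this cycle at \<open>u\<close> is no bridge
either. Of the three vertices \<open>u\<close>, \<open>w\<close>, \<open>z\<close> of one component without bridges only one can be the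
root or a lower end, and it is not \<open>u\<close>; this leaves a third clique vertex.
\<close>

lemma card_clique_ne_2: "card (V - lower_ends) \<noteq> 2"
proof
  assume card: "card (V - lower_ends) = 2"
  have "c \<in> V - lower_ends" using root_in_V root_not_lower_end by simp
  then have "card (V - lower_ends - {c}) = 1"
    using card finite_V by (simp add: card_Diff_singleton)
  then obtain u where u: "V - lower_ends - {c} = {u}"
    by (rule card_1_singletonE)
  then have "u \<in> V" "u \<notin> lower_ends" "u \<noteq> c" by auto
  obtain w where w: "(w, u) \<in> E" "(c, w) \<in> {(y, z) \<in> E. y \<noteq> u \<and> z \<noteq> u}\<^sup>*"
    by (rule last_arc_avoiding[OF connected_E[OF \<open>u \<in> V\<close>] \<open>u \<noteq> c\<close>[symmetric]])
  have nb_w: "{w, u} \<notin> bridges"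
  proof
    assume b: "{w, u} \<in> bridges"
    have "(c, w) \<in> (del {w, u})\<^sup>*"
      by (rule rtrancl_mono[THEN subsetD, OF _ w(2)]) (auto simp: del_def doubleton_eq_iff)
    then have "w \<noteq> lower_end {w, u}"
      using lower_end_below[OF b] unfolding below_def by auto
    from b show False
      by (cases rule: bridge_ends) (use \<open>w \<noteq> lower_end {w, u}\<close> \<open>u \<notin> lower_ends\<close> in auto)
  qed
  have "w \<noteq> u" using w(1) irrefl_E by auto
  have "(w, u) \<in> (del {w, u})\<^sup>*"
    using nb_w w(1) unfolding bridges_def by blast
  then obtain z where z: "(z, u) \<in> del {w, u}" "(w, z) \<in> {(y, z) \<in> del {w, u}. y \<noteq> u \<and> z \<noteq> u}\<^sup>*"
    by (rule last_arc_avoiding[OF _ \<open>w \<noteq> u\<close>])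
  then have zE: "(z, u) \<in> E" "z \<noteq> w"
    by (auto simp: del_def)
  have nb_z: "{z, u} \<notin> bridges"
  proof
    assume b: "{z, u} \<in> bridges"
    have "(w, z) \<in> (del {z, u})\<^sup>*"
      by (rule rtrancl_mono[THEN subsetD, OF _ z(2)]) (auto simp: del_def doubleton_eq_iff)
    moreover have "(u, w) \<in> del {z, u}"
      using sym_E[OF w(1)] zE by (auto simp: del_def doubleton_eq_iff)
    ultimately have uz: "(u, z) \<in> (del {z, u})\<^sup>*"
      by (rule converse_rtrancl_into_rtrancl[rotated])
    have "z \<in> below {z, u} \<longleftrightarrow> u \<in> below {z, u}"
      using uz sym_rtrancl_del[OF uz] unfolding below_def by (auto dest: rtrancl_trans)
    moreover obtain s where "{s, lower_end {z, u}} = {z, u}" "s \<notin> below {z, u}" "lower_end {z, u} \<in> below {z, u}"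
      by (rule bridge_cases[OF b])
    ultimately show False
      by (metis doubleton_eq_iff)
  qed
  have "same_side w z"
    using same_side_adjacent[OF w(1) nb_w] same_side_adjacent[OF zE(1) nb_z]
    by (blast intro: same_side_sym same_side_trans)
  then obtain y where "y \<in> {w, z}" "y \<notin> insert c lower_ends"
    using same_side_unique[of w z] zE(2) by blast
  moreover have "y \<in> V" "y \<noteq> u"
    using w(1) zE(1) E_subset irrefl_E \<open>y \<in> {w, z}\<close> by auto
  ultimately show False
    using u by auto
qed

end

section \<open>Connectedness, cut edges and distances\<close>

lemma connected_symmetric_iff:
  assumes "E \<subseteq> V \<times> V" "sym E"
  shows "Digraph_Component.connected (with_proj \<lparr>pverts = V, parcs = E\<rparr>)
    \<longleftrightarrow> V \<noteq> {} \<and> (\<forall>u\<in>V. \<forall>v\<in>V. (u, v) \<in> E\<^sup>*)"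
proof -
  have "mk_symmetric (with_proj \<lparr>pverts = V, parcs = E\<rparr>) = \<lparr>pverts = V, parcs = E\<rparr>"
    using assms(2) by (auto simp: mk_symmetric_def sym_def)
  moreover have "(u, v) \<in> rtrancl_on V E \<longleftrightarrow> (u, v) \<in> E\<^sup>*" if "u \<in> V" "v \<in> V" for u v
    using that assms(1)
    by (auto intro: rtrancl_on_rtranclI rtrancl_consistent_rtrancl_on)
  ultimately show ?thesis
    by (simp add: Digraph_Component.connected_def strongly_connected_def reachable_def)
qed

context rooted_graph begin

abbreviation graph :: "'a pair_pre_digraph" where
  "graph \<equiv> \<lparr>pverts = V, parcs = E\<rparr>"

lemma pair_graph: "pair_graph graph"
proof
  show "symmetric (with_proj graph)"
    using sym_E by (auto simp: symmetric_def sym_def)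
qed (use E_subset finite_V finite_E irrefl_E in auto)

lemma sym_rtrancl_E: "(u, v) \<in> E\<^sup>* \<Longrightarrow> (v, u) \<in> E\<^sup>*"
  by (rule symD[OF sym_rtrancl]) (auto simp: sym_def intro: sym_E)

lemma reachable_E: "u \<in> V \<Longrightarrow> v \<in> V \<Longrightarrow> (u, v) \<in> E\<^sup>*"
  by (meson connected_E rtrancl_trans sym_rtrancl_E)

lemma connected_graph: "Digraph_Component.connected (with_proj graph)"
  using reachable_E root_in_V sym_E
  by (subst connected_symmetric_iff[OF E_subset]) (auto simp: sym_def)

lemma cut_edges_eq_bridges: "cut_edges graph = bridges"
proof -
  have "\<not> Digraph_Component.connected (with_proj \<lparr>pverts = V, parcs = E - {(u, v), (v, u)}\<rparr>)
      \<longleftrightarrow> (u, v) \<notin> (del {u, v})\<^sup>*" if "(u, v) \<in> E" for u v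
  proof -
    have del: "E - {(u, v), (v, u)} = del {u, v}"
      by (auto simp: del_def doubleton_eq_iff)
    have "sym (del {u, v})" "del {u, v} \<subseteq> V \<times> V"
      using sym_E E_subset by (auto simp: sym_def del_def insert_commute)
    then have "Digraph_Component.connected (with_proj \<lparr>pverts = V, parcs = del {u, v}\<rparr>)
      \<longleftrightarrow> (\<forall>a\<in>V. \<forall>b\<in>V. (a, b) \<in> (del {u, v})\<^sup>*)"
      using root_in_V by (subst connected_symmetric_iff) auto
    also have "\<dots> \<longleftrightarrow> (u, v) \<in> (del {u, v})\<^sup>*"
    proof
      assume uv: "(u, v) \<in> (del {u, v})\<^sup>*"
      have "E \<subseteq> (del {u, v})\<^sup>*"
      proof (rule subrelI)
        fix a b assume ab: "(a, b) \<in> E"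
        show "(a, b) \<in> (del {u, v})\<^sup>*"
        proof (cases "{a, b} = {u, v}")
          case True
          then show ?thesis
            using uv sym_rtrancl_del[OF uv] by (auto simp: doubleton_eq_iff)
        next
          case False
          with ab show ?thesis by (auto simp: del_def)
        qed
      qed
      then show "\<forall>a\<in>V. \<forall>b\<in>V. (a, b) \<in> (del {u, v})\<^sup>*"
        using reachable_E rtrancl_subset_rtrancl by blast
    qed (use that E_subset in auto)
    finally show ?thesis
      unfolding del by blast
  qed
  then show ?thesis
    unfolding cut_edges_def bridges_def by auto
qed

text \<open>
The walk \<open>q\<close> makes the infimum over all walks finite, so that passing from extended to real
numbers is harmless.
\<close>

lemma graph_dist_bounds:
  assumes "\<And>p. pre_digraph.awalk (with_proj graph) u p v \<Longrightarrow> k \<le> length p"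
    and "pre_digraph.awalk (with_proj graph) u q v"
  shows "real k \<le> graph_dist graph u v" "graph_dist graph u v \<le> real (length q)"
proof -
  interpret pair_graph graph by (rule pair_graph)
  have cost: "awalk_cost (\<lambda>_. 1) p = real (length p)" for p :: "('a \<times> 'a) list"
    by (induction p) auto
  have "ereal (real k) \<le> \<mu> (\<lambda>_. 1) u v"
    unfolding \<mu>_def using assms(1) by (intro INF_greatest) (simp add: cost)
  moreover have "\<mu> (\<lambda>_. 1) u v \<le> ereal (real (length q))"
    unfolding \<mu>_def using assms(2) by (intro INF_lower2[of q]) (auto simp: cost)
  ultimately show "real k \<le> graph_dist graph u v" "graph_dist graph u v \<le> real (length q)"
    unfolding graph_dist_def by (cases "\<mu> (\<lambda>_. 1) u v"; simp)+
qed

lemma graph_dist_sym: "graph_dist graph u v = graph_dist graph v u"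
proof -
  interpret pair_graph graph by (rule pair_graph)
  have cost: "awalk_cost (\<lambda>_. 1) (rev_path p) = awalk_cost (\<lambda>_. 1) p" for p :: "('a \<times> 'a) list"
    by (induction p) auto
  have "\<mu> (\<lambda>_. 1) u v \<le> \<mu> (\<lambda>_. 1) v u" for u v
    unfolding \<mu>_def
    by (rule INF_mono) (metis awalk_rev_path cost mem_Collect_eq order_refl)
  then have "\<mu> (\<lambda>_. 1) u v = \<mu> (\<lambda>_. 1) v u"
    by (rule order_antisym) fact
  then show ?thesis
    by (simp add: graph_dist_def)
qed

lemma graph_dist_adjacent:
  assumes "(u, v) \<in> E"
  shows "graph_dist graph u v = 1"
proof -
  interpret pair_graph graph by (rule pair_graph)
  have "awalk u [(u, v)] v"
    using assms E_subset by (auto simp: awalk_def)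
  moreover have "1 \<le> length p" if "awalk u p v" for p
    using that assms irrefl_E by (cases p) (auto simp: awalk_def)
  ultimately show ?thesis
    using graph_dist_bounds[of u v 1 "[(u, v)]"] by simp
qed

lemma graph_dist_nonadjacent_ge:
  assumes "u \<in> V" "v \<in> V" "u \<noteq> v" "(u, v) \<notin> E"
  shows "graph_dist graph u v \<ge> 2"
proof -
  interpret pair_graph graph by (rule pair_graph)
  have "u \<rightarrow>\<^sup>*\<^bsub>with_proj graph\<^esub> v"
    using reachable_E[OF assms(1,2)] assms(1,2) E_subset unfolding reachable_def
    by (auto intro!: rtrancl_consistent_rtrancl_on)
  then obtain q where "awalk u q v"
    by (auto simp: reachable_awalk)
  moreover have "2 \<le> length p" if "awalk u p v" for p
  proof -
    consider "p = []" | e where "p = [e]" | e f r where "p = e # f # r"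
      by (metis neq_Nil_conv)
    then show ?thesis
      by cases (use that assms in \<open>auto simp: awalk_def\<close>)
  qed
  ultimately show ?thesis
    using graph_dist_bounds(1)[of u v 2 q] by simp
qed

lemma graph_dist_common_neighbour:
  assumes "(u, w) \<in> E" "(w, v) \<in> E" "u \<noteq> v" "(u, v) \<notin> E"
  shows "graph_dist graph u v = 2"
proof -
  interpret pair_graph graph by (rule pair_graph)
  have V: "u \<in> V" "v \<in> V" using assms E_subset by auto
  have "awalk u [(u, w), (w, v)] v"
    using assms E_subset by (auto simp: awalk_def)
  moreover have "0 \<le> length p" for p :: "('a \<times> 'a) list"
    by simp
  ultimately have "graph_dist graph u v \<le> 2"
    using graph_dist_bounds(2)[of u v 0 "[(u, w), (w, v)]"] by simp
  with graph_dist_nonadjacent_ge[OF V assms(3,4)] show ?thesis by simp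
qed

definition harary_kernel :: "'a \<Rightarrow> 'a \<Rightarrow> real" where
  "harary_kernel u v = (if u = v then 0 else 1 / graph_dist graph u v)"

lemma harary_kernel_sym: "harary_kernel u v = harary_kernel v u"
  using graph_dist_sym[of u v] by (simp add: harary_kernel_def)

lemma harary_kernel_pos:
  assumes "u \<in> V" "v \<in> V" "u \<noteq> v"
  shows "harary_kernel u v > 0"
  using graph_dist_adjacent[of u v] graph_dist_nonadjacent_ge[OF assms] assms(3)
  by (cases "(u, v) \<in> E") (auto simp: harary_kernel_def)

text \<open>
The Harary matrix is the matrix of \<open>harary_kernel\<close> with respect to any enumeration of the vertices.
\<close>

lemma harary_radius_rayleigh:
  obtains x where "\<And>v. x v \<ge> 0" "(\<Sum>v\<in>V. (x v)\<^sup>2) = 1"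
    "quad_form V harary_kernel x = harary_radius graph"
    "\<And>y. quad_form V harary_kernel y \<le> harary_radius graph * (\<Sum>v\<in>V. (y v)\<^sup>2)"
proof -
  have nonneg: "harary_kernel u v \<ge> 0" if "u \<in> V" "v \<in> V" for u v
    using harary_kernel_pos[OF that] by (cases "u = v") (auto simp: harary_kernel_def)
  have "V \<noteq> {}" using root_in_V by auto
  obtain x where x: "\<And>v. x v \<ge> 0" "(\<Sum>v\<in>V. (x v)\<^sup>2) = 1"
    "\<And>y. quad_form V harary_kernel y \<le> quad_form V harary_kernel x * (\<Sum>v\<in>V. (y v)\<^sup>2)"
    by (rule quad_form_nonneg_maximum_exists[OF finite_V \<open>V \<noteq> {}\<close>, of harary_kernel]) (use nonneg in auto)
  obtain vs where vs: "set vs = V" "distinct vs"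
    using finite_distinct_list[OF finite_V] by blast
  have "harary_matrix graph vs = mat (length vs) (length vs) (\<lambda>(i, j). harary_kernel (vs ! i) (vs ! j))"
    using vs(2) by (intro eq_matI) (auto simp: harary_matrix_def harary_kernel_def nth_eq_iff_index_eq)
  then have "harary_radius graph = quad_form V harary_kernel x"
    using spectral_radius_eq_quad_form_maximum[where k = harary_kernel and x = x,
        OF vs(2,1) \<open>V \<noteq> {}\<close> harary_kernel_sym nonneg x]
    by (subst harary_radius_eq[OF vs(2)]) (simp_all add: vs(1))
  with x that show ?thesis by metis
qed

end

section \<open>The extremal graph\<close>

lemma digraph_iso_by_bij_betw:
  assumes "pair_graph G" "bij_betw f (pverts G) (pverts H)" "parcs H \<subseteq> pverts H \<times> pverts H"
    and arcs: "\<And>u v. u \<in> pverts G \<Longrightarrow> v \<in> pverts G \<Longrightarrow> (u, v) \<in> parcs G \<longleftrightarrow> (f u, f v) \<in> parcs H"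
  shows "digraph_iso (with_proj G) (with_proj H)"
proof -
  interpret pair_graph G by fact
  define hom where "hom = \<lparr>iso_verts = f, iso_arcs = map_prod f f, iso_head = snd, iso_tail = fst\<rparr>"
  have inj: "inj_on f (pverts G)" and surj: "f ` pverts G = pverts H"
    using assms(2) by (auto simp: bij_betw_def)
  have sub: "parcs G \<subseteq> pverts G \<times> pverts G"
    using wellformed' by auto
  have "inj_on (map_prod f f) (parcs G)"
    by (rule inj_on_subset[OF map_prod_inj_on[OF inj inj] sub])
  then have "digraph_isomorphism hom"
    using inj wf_digraph_axioms by (auto simp: digraph_isomorphism_def hom_def)
  moreover have "map_prod f f ` parcs G = parcs H"
  proof
    show "map_prod f f ` parcs G \<subseteq> parcs H"
      using sub arcs by auto
    show "parcs H \<subseteq> map_prod f f ` parcs G"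
    proof (rule subrelI)
      fix i j assume ij: "(i, j) \<in> parcs H"
      then obtain u v where "u \<in> pverts G" "v \<in> pverts G" "i = f u" "j = f v"
        using assms(3) surj by blast
      with ij arcs show "(i, j) \<in> map_prod f f ` parcs G"
        by (intro image_eqI[of _ _ "(u, v)"]) auto
    qed
  qed
  then have "with_proj H = app_iso hom (with_proj G)"
    using surj by (simp add: app_iso_def hom_def with_proj_def)
  ultimately show ?thesis
    unfolding digraph_iso_def by blast
qed

text \<open>
Reciprocal distances as they would be if all distances of distinct nonadjacent vertices were two.
It dominates the Harary kernel, agrees with it on graphs of diameter at most two, and depends on
the graph only through its arcs, so that forms of two graphs are compared by comparing the weights
of their arcs.
\<close>

definition diameter_two_kernel :: "'a rel \<Rightarrow> 'a \<Rightarrow> 'a \<Rightarrow> real" where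
  "diameter_two_kernel E u v = (of_bool (u \<noteq> v) + of_bool ((u, v) \<in> E)) / 2"

lemma quad_form_diameter_two_kernel:
  assumes "finite V" "E \<subseteq> V \<times> V"
  shows "quad_form V (diameter_two_kernel E) x
    = (quad_form V (\<lambda>u v. of_bool (u \<noteq> v)) x + (\<Sum>(u, v)\<in>E. x u * x v)) / 2"
proof -
  have "(\<Sum>u\<in>V. \<Sum>v\<in>V. of_bool ((u, v) \<in> E) * x u * x v)
      = (\<Sum>p\<in>V \<times> V. if p \<in> E then x (fst p) * x (snd p) else 0)"
    unfolding sum.cartesian_product by (intro sum.cong) auto
  also have "\<dots> = (\<Sum>p\<in>V \<times> V \<inter> E. x (fst p) * x (snd p))"
    using assms(1) by (simp add: sum.inter_restrict)
  also have "V \<times> V \<inter> E = E"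
    using assms(2) by blast
  finally have E: "(\<Sum>u\<in>V. \<Sum>v\<in>V. of_bool ((u, v) \<in> E) * x u * x v) = (\<Sum>(u, v)\<in>E. x u * x v)"
    by (simp add: case_prod_unfold)
  have "diameter_two_kernel E u v * x u * x v
      = (of_bool (u \<noteq> v) * x u * x v + of_bool ((u, v) \<in> E) * x u * x v) / 2" for u v
    by (simp add: diameter_two_kernel_def)
  then show ?thesis
    unfolding quad_form_def E[symmetric]
    by (simp only: sum_divide_distrib[symmetric] sum.distrib)
qed

context rooted_graph begin

lemma harary_kernel_le_diameter_two_kernel:
  assumes "u \<in> V" "v \<in> V"
  shows "harary_kernel u v \<le> diameter_two_kernel E u v"
proof (cases "u = v \<or> (u, v) \<in> E")
  case True
  then show ?thesis
    using irrefl_E graph_dist_adjacent[of u v]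
    by (auto simp: harary_kernel_def diameter_two_kernel_def)
next
  case False
  then show ?thesis
    using graph_dist_nonadjacent_ge[OF assms]
    by (auto simp: harary_kernel_def diameter_two_kernel_def field_simps)
qed

text \<open>
At a zero of \<open>x\<close> the eigenvector equation makes a sum of nonnegative terms vanish; as the kernel is
positive off the diagonal, \<open>x\<close> would be zero everywhere.
\<close>

lemma rayleigh_maximiser_pos:
  assumes x: "\<And>v. x v \<ge> 0" "(\<Sum>v\<in>V. (x v)\<^sup>2) = 1"
    and eq: "quad_form V harary_kernel x = harary_radius graph"
    and max: "\<And>y. quad_form V harary_kernel y \<le> harary_radius graph * (\<Sum>v\<in>V. (y v)\<^sup>2)"
    and u: "u \<in> V"
  shows "x u > 0"
proof (rule ccontr)
  assume "\<not> x u > 0"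
  with x(1)[of u] have "x u = 0" by simp
  have "(\<Sum>v\<in>V. harary_kernel u v * x v) = harary_radius graph * x u"
    by (rule quad_form_maximiser_eigenvector[OF finite_V harary_kernel_sym max _ u])
      (simp add: x(2) eq)
  then have sum0: "(\<Sum>v\<in>V. harary_kernel u v * x v) = 0"
    by (simp add: \<open>x u = 0\<close>)
  have nonneg: "harary_kernel u v * x v \<ge> 0" if "v \<in> V" for v
    using harary_kernel_pos[OF u that] x(1)[of v] by (cases "u = v") (auto simp: harary_kernel_def)
  have "x v = 0" if "v \<in> V" for v
  proof (cases "u = v")
    case False
    have "harary_kernel u v * x v = 0"
      using sum0 sum_nonneg_eq_0_iff[OF finite_V nonneg] that by simp
    with harary_kernel_pos[OF u that False] show ?thesis by simp
  qed (use \<open>x u = 0\<close> in simp)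
  with x(2) show False by simp
qed

lemma rooted_graph_pendant_clique: "rooted_graph V pendant_clique_arcs c"
proof
  fix v assume "v \<in> V"
  then show "(c, v) \<in> pendant_clique_arcs\<^sup>*"
    using root_in_V by (cases "v = c") (auto simp: pendant_clique_arcs_def)
qed (auto simp: pendant_clique_arcs_def finite_V root_in_V)

text \<open>
The pendant edges are bridges. An edge inside the clique is none, since a clique that contains
an edge has a third vertex.
\<close>

lemma card_bridges_pendant_clique:
  "card (rooted_graph.bridges pendant_clique_arcs) = card lower_ends"
proof -
  interpret H: rooted_graph V pendant_clique_arcs c
    by (rule rooted_graph_pendant_clique)
  have "H.bridges = (\<lambda>t. {t, c}) ` lower_ends"
  proof (intro equalityI subsetI)
    fix e assume "e \<in> H.bridges"
    then obtain u v where e: "e = {u, v}" "(u, v) \<in> pendant_clique_arcs" "(u, v) \<notin> (H.del e)\<^sup>*"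
      unfolding H.bridges_def by blast
    have "u \<in> lower_ends \<or> v \<in> lower_ends"
    proof (rule ccontr)
      assume lower_ends: "\<not> (u \<in> lower_ends \<or> v \<in> lower_ends)"
      have uv: "{u, v} \<subseteq> V - lower_ends" "u \<noteq> v"
        using e(2) lower_ends by (auto simp: pendant_clique_arcs_def)
      then have "V - lower_ends \<noteq> {u, v}"
        using card_clique_ne_2 by force
      then obtain w where "w \<in> V - lower_ends" "w \<noteq> u" "w \<noteq> v"
        using uv by blast
      then have "(u, w) \<in> pendant_clique_arcs" "(w, v) \<in> pendant_clique_arcs"
        using uv by (auto simp: pendant_clique_arcs_def)
      then have "(u, w) \<in> H.del e" "(w, v) \<in> H.del e"
        using \<open>w \<noteq> u\<close> \<open>w \<noteq> v\<close> by (simp_all add: H.del_def e(1) doubleton_eq_iff)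
      then have "(u, v) \<in> (H.del e)\<^sup>*"
        by (rule rtrancl_into_rtrancl[OF r_into_rtrancl])
      with e(3) show False ..
    qed
    then show "e \<in> (\<lambda>t. {t, c}) ` lower_ends"
      using e(1,2) root_not_lower_end by (auto simp: pendant_clique_arcs_def)
  next
    fix e assume "e \<in> (\<lambda>t. {t, c}) ` lower_ends"
    then obtain t where t: "t \<in> lower_ends" "e = {t, c}" by blast
    then have tc: "t \<noteq> c" "t \<in> V"
      using root_not_lower_end lower_ends_subset by auto
    then have "(t, c) \<in> pendant_clique_arcs"
      using root_in_V by (auto simp: pendant_clique_arcs_def)
    moreover have "(t, c) \<notin> (H.del {t, c})\<^sup>*"
    proof
      assume "(t, c) \<in> (H.del {t, c})\<^sup>*"
      then obtain y where "(t, y) \<in> H.del {t, c}"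
        by (cases rule: converse_rtranclE) (use tc(1) in auto)
      then have "(t, y) \<in> pendant_clique_arcs" "y \<noteq> c"
        by (auto simp: H.del_def)
      then show False
        using t(1) tc(1) by (simp add: pendant_clique_arcs_def)
    qed
    ultimately show "e \<in> H.bridges"
      unfolding H.bridges_def t(2) by blast
  qed
  moreover have "inj_on (\<lambda>t. {t, c}) lower_ends"
    using root_not_lower_end by (auto simp: inj_on_def doubleton_eq_iff)
  ultimately show ?thesis
    by (simp add: card_image)
qed

lemma pendant_clique_kernel:
  assumes "u \<in> V" "v \<in> V"
  shows "rooted_graph.harary_kernel V pendant_clique_arcs u v = diameter_two_kernel pendant_clique_arcs u v"
proof -
  interpret H: rooted_graph V pendant_clique_arcs c
    by (rule rooted_graph_pendant_clique)
  consider "u = v" | "(u, v) \<in> pendant_clique_arcs" "u \<noteq> v"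
    | "(u, v) \<notin> pendant_clique_arcs" "u \<noteq> v" "u \<noteq> c" "v \<noteq> c"
    using assms by (auto simp: pendant_clique_arcs_def)
  then show ?thesis
  proof cases
    case 1
    then show ?thesis
      by (simp add: H.harary_kernel_def diameter_two_kernel_def H.irrefl_E)
  next
    case 2
    then show ?thesis
      by (simp add: H.harary_kernel_def diameter_two_kernel_def H.graph_dist_adjacent)
  next
    case 3
    then have "(u, c) \<in> pendant_clique_arcs" "(c, v) \<in> pendant_clique_arcs"
      using assms root_in_V by (auto simp: pendant_clique_arcs_def)
    with 3 show ?thesis
      by (simp add: H.harary_kernel_def diameter_two_kernel_def H.graph_dist_common_neighbour)
  qed
qed

text \<open>
Subtracting the eigenvector equations at \<open>c\<close> and \<open>v\<close> gives
\<open>(r + 1) * (x c - x v) = (\<Sum>z\<in>V. d z)\<close>, where \<open>d z\<close> is half of \<open>x z\<close> if \<open>z\<close> is a vertex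
other than \<open>v\<close> and not adjacent to \<open>v\<close>, and zero otherwise. Such a \<open>z\<close> exists: any third vertex if
\<open>v\<close> is pendant, any pendant vertex if \<open>v\<close> is in the clique.
\<close>

lemma pendant_clique_eigenvector_root_maximal:
  assumes pos: "\<And>v. v \<in> V \<Longrightarrow> x v > 0" and "r \<ge> 0"
    and eigen: "\<And>u. u \<in> V \<Longrightarrow> (\<Sum>v\<in>V. diameter_two_kernel pendant_clique_arcs u v * x v) = r * x u"
    and v: "v \<in> V" and w: "w \<in> V" "distinct [c, v, w]" and "lower_ends \<noteq> {}"
  shows "x v < x c"
proof -
  let ?k = "diameter_two_kernel pendant_clique_arcs"
  define d where "d = (\<lambda>z. if z = c \<or> z = v then 0 else (1 - ?k v z) * x z)"
  have d_nonneg: "d z \<ge> 0" if "z \<in> V" for z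
    using pos[OF that] by (auto simp: d_def diameter_two_kernel_def)
  obtain y where y: "y \<in> V" "y \<noteq> c" "y \<noteq> v" "(v, y) \<notin> pendant_clique_arcs"
  proof (cases "v \<in> lower_ends")
    case True
    with w show ?thesis
      by (intro that[of w]) (auto simp: pendant_clique_arcs_def)
  next
    case False
    obtain t where "t \<in> lower_ends" using \<open>lower_ends \<noteq> {}\<close> by blast
    with False root_not_lower_end lower_ends_subset w show ?thesis
      by (intro that[of t]) (auto simp: pendant_clique_arcs_def)
  qed
  have "0 < d y"
    using y pos[of y] by (simp add: d_def diameter_two_kernel_def)
  also have "d y \<le> (\<Sum>z\<in>V. d z)"
    by (rule member_le_sum) (use y d_nonneg finite_V in auto)
  finally have d_pos: "(\<Sum>z\<in>V. d z) > 0" .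
  have kc: "?k c z = of_bool (z \<noteq> c)" if "z \<in> V" for z
    using that root_in_V by (auto simp: diameter_two_kernel_def pendant_clique_arcs_def)
  have kv: "?k v c = 1" "?k v v = 0"
    using v root_in_V w by (auto simp: diameter_two_kernel_def pendant_clique_arcs_def)
  have "r * (x c - x v) = (\<Sum>z\<in>V. ?k c z * x z) - (\<Sum>z\<in>V. ?k v z * x z)"
    using eigen[OF root_in_V] eigen[OF v] by (simp add: right_diff_distrib)
  also have "\<dots> = (\<Sum>z\<in>V. d z + (if z = v then x z else 0) - (if z = c then x z else 0))"
    unfolding sum_subtractf[symmetric]
    by (rule sum.cong) (use w kc kv in \<open>auto simp: d_def algebra_simps\<close>)
  also have "\<dots> = (\<Sum>z\<in>V. d z) + x v - x c"
    using v root_in_V finite_V by (simp add: sum.distrib sum_subtractf)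
  finally have "(r + 1) * (x c - x v) > 0"
    using d_pos by (simp add: algebra_simps)
  then show ?thesis
    using \<open>r \<ge> 0\<close> by (simp add: zero_less_mult_iff)
qed

lemma pendant_clique_iso:
  "digraph_iso (with_proj \<lparr>pverts = V, parcs = pendant_clique_arcs\<rparr>)
    (with_proj (complete_pendant (card (V - lower_ends)) (card lower_ends)))"
proof -
  let ?t = "card (V - lower_ends)" and ?p = "card lower_ends"
  have fin: "finite lower_ends" "finite (V - lower_ends)"
    using finite_subset[OF lower_ends_subset finite_V] finite_V by auto
  have c: "c \<in> V - lower_ends" using root_in_V root_not_lower_end by simp
  then have t_pos: "?t > 0" using fin(2) by (auto simp: card_gt_0_iff)
  have "\<exists>g. bij_betw g (V - lower_ends - {c}) {1..<?t}"
    using fin(2) card_Diff_singleton[OF c] by (intro finite_same_card_bij) simp_all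
  then obtain g where g: "bij_betw g (V - lower_ends - {c}) {1..<?t}" ..
  have "\<exists>h. bij_betw h lower_ends {?t..<?t + ?p}"
    using fin(1) by (intro finite_same_card_bij) simp_all
  then obtain h where h: "bij_betw h lower_ends {?t..<?t + ?p}" ..
  define f where "f = (\<lambda>v. if v = c then 0 else if v \<in> lower_ends then h v else g v)"
  have "bij_betw f {c} {0}"
    by (simp add: f_def bij_betw_def)
  moreover have "bij_betw f (V - lower_ends - {c}) {1..<?t}"
    using g by (rule bij_betw_cong[THEN iffD1, rotated]) (auto simp: f_def)
  moreover have "bij_betw f lower_ends {?t..<?t + ?p}"
    using h by (rule bij_betw_cong[THEN iffD1, rotated]) (use root_not_lower_end in \<open>auto simp: f_def\<close>)
  ultimately have "bij_betw f ({c} \<union> (V - lower_ends - {c}) \<union> lower_ends) ({0} \<union> {1..<?t} \<union> {?t..<?t + ?p})"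
    using t_pos by (intro bij_betw_combine) auto
  moreover have "{c} \<union> (V - lower_ends - {c}) \<union> lower_ends = V"
    using root_in_V lower_ends_subset by auto
  moreover have "{0} \<union> {1..<?t} \<union> {?t..<?t + ?p} = {0..<?t + ?p}"
    using t_pos by auto
  ultimately have bij: "bij_betw f V {0..<?t + ?p}" by simp
  have f0: "f v = 0 \<longleftrightarrow> v = c" and ft: "f v < ?t \<longleftrightarrow> v \<notin> lower_ends" if "v \<in> V" for v
  proof -
    have "f c = 0" by (simp add: f_def)
    then show "f v = 0 \<longleftrightarrow> v = c"
      using inj_on_eq_iff[OF bij_betw_imp_inj_on[OF bij] that root_in_V] by simp
    have "h v \<ge> ?t" if "v \<in> lower_ends" using h that by (auto simp: bij_betw_def)
    moreover have "g v < ?t" if "v \<notin> lower_ends" "v \<noteq> c"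
      using g that \<open>v \<in> V\<close> by (auto simp: bij_betw_def)
    ultimately show "f v < ?t \<longleftrightarrow> v \<notin> lower_ends"
      using t_pos root_not_lower_end by (auto simp: f_def)
  qed
  show ?thesis
  proof (rule digraph_iso_by_bij_betw[where f = f])
    show "pair_graph \<lparr>pverts = V, parcs = pendant_clique_arcs\<rparr>"
      by (rule rooted_graph.pair_graph[OF rooted_graph_pendant_clique])
    show "bij_betw f (pverts \<lparr>pverts = V, parcs = pendant_clique_arcs\<rparr>)
        (pverts (complete_pendant ?t ?p))"
      using bij by (simp add: complete_pendant_def)
    show "parcs (complete_pendant ?t ?p)
        \<subseteq> pverts (complete_pendant ?t ?p) \<times> pverts (complete_pendant ?t ?p)"
      using t_pos by (auto simp: complete_pendant_def)
    fix u v
    assume "u \<in> pverts \<lparr>pverts = V, parcs = pendant_clique_arcs\<rparr>"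
      "v \<in> pverts \<lparr>pverts = V, parcs = pendant_clique_arcs\<rparr>"
    then have V: "u \<in> V" "v \<in> V" by auto
    have "f u = f v \<longleftrightarrow> u = v"
      by (rule inj_on_eq_iff[OF bij_betw_imp_inj_on[OF bij] V])
    moreover have "f u < ?t + ?p" "f v < ?t + ?p"
      using bij_betwE[OF bij] V by auto
    moreover have "?t \<le> f u \<longleftrightarrow> u \<in> lower_ends" "?t \<le> f v \<longleftrightarrow> v \<in> lower_ends"
      using ft V by (simp_all flip: not_less)
    ultimately show "(u, v) \<in> parcs \<lparr>pverts = V, parcs = pendant_clique_arcs\<rparr>
        \<longleftrightarrow> (f u, f v) \<in> parcs (complete_pendant ?t ?p)"
      using root_not_lower_end
      by (simp add: complete_pendant_def pendant_clique_arcs_def V f0 ft) blast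
  qed
qed

end

section \<open>The maximum of the Harary spectral radius\<close>

theorem theorem5p3:
  fixes G :: "'a pair_pre_digraph" and n p :: nat
  assumes "G \<in> conn_graphs_cut_edges n p"
    and "\<And>H :: 'a pair_pre_digraph. H \<in> conn_graphs_cut_edges n p \<Longrightarrow>
           harary_radius H \<le> harary_radius G"
  shows "digraph_iso (with_proj G) (with_proj (complete_pendant (n - p) p))"
proof -
  define V E where "V = pverts G" and "E = parcs G"
  have G: "G = \<lparr>pverts = V, parcs = E\<rparr>"
    by (simp add: V_def E_def)
  interpret G: pair_graph G
    using assms(1) by (simp add: conn_graphs_cut_edges_def)
  have E: "E \<subseteq> V \<times> V" "sym E"
    using G.wellformed' G.arcs_symmetric by (auto simp: V_def E_def sym_def)
  have conn: "V \<noteq> {}" "\<And>u v. u \<in> V \<Longrightarrow> v \<in> V \<Longrightarrow> (u, v) \<in> E\<^sup>*"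
    using assms(1) connected_symmetric_iff[OF E] by (auto simp: conn_graphs_cut_edges_def G)
  have rooted: "rooted_graph V E c" if "c \<in> V" for c
  proof
    show "finite V" unfolding V_def by (rule G.pair_finite_verts)
    show "(u, u) \<notin> E" for u using G.no_loops'[of u u] by (auto simp: E_def)
    show "(v, u) \<in> E" if "(u, v) \<in> E" for u v using that E(2) by (auto simp: sym_def)
  qed (use that E conn in auto)
  obtain c\<^sub>0 where "c\<^sub>0 \<in> V" using conn(1) by blast
  interpret G0: rooted_graph V E c\<^sub>0 by (rule rooted) fact
  obtain x where x: "\<And>v. x v \<ge> 0" "(\<Sum>v\<in>V. (x v)\<^sup>2) = 1"
    "quad_form V G0.harary_kernel x = harary_radius G"
    "\<And>y. quad_form V G0.harary_kernel y \<le> harary_radius G * (\<Sum>v\<in>V. (y v)\<^sup>2)"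
    using G0.harary_radius_rayleigh unfolding G by blast
  have pos: "x v > 0" if "v \<in> V" for v
    using G0.rayleigh_maximiser_pos[OF x[unfolded G] that] .
  \<comment> \<open>The kernel and its maximiser do not depend on the root, which is chosen only now.\<close>
  obtain c where c: "c \<in> V" "\<And>v. v \<in> V \<Longrightarrow> x v \<le> x c"
  proof -
    have "Max (x ` V) \<in> x ` V"
      using G0.finite_V conn(1) by (intro Max_in) auto
    then obtain c where "c \<in> V" "Max (x ` V) = x c" by auto
    with G0.finite_V show ?thesis
      by (intro that[of c]) (auto simp flip: \<open>Max (x ` V) = x c\<close>)
  qed
  interpret R: rooted_graph V E c by (rule rooted) fact
  let ?F = R.pendant_clique_arcs
  interpret H: rooted_graph V ?F c by (rule R.rooted_graph_pendant_clique)
  have n: "card V = n" and p: "card R.lower_ends = p"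
    using assms(1) R.cut_edges_eq_bridges R.card_lower_ends by (auto simp: conn_graphs_cut_edges_def G)
  have "H.graph \<in> conn_graphs_cut_edges n p"
    using H.pair_graph H.connected_graph H.cut_edges_eq_bridges R.card_bridges_pendant_clique n p
    by (simp add: conn_graphs_cut_edges_def)
  then have le: "harary_radius H.graph \<le> harary_radius G"
    by (rule assms(2))
  obtain z where z: "\<And>y. quad_form V H.harary_kernel y \<le> harary_radius H.graph * (\<Sum>v\<in>V. (y v)\<^sup>2)"
    using H.harary_radius_rayleigh by blast
  have kernel: "quad_form V H.harary_kernel x = quad_form V (diameter_two_kernel ?F) x"
    by (simp add: quad_form_def R.pendant_clique_kernel cong: sum.cong)
  have form_E: "quad_form V (diameter_two_kernel E) x
      = (quad_form V (\<lambda>u v. of_bool (u \<noteq> v)) x + (\<Sum>(u, v)\<in>E. x u * x v)) / 2"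
    and form_F: "quad_form V (diameter_two_kernel ?F) x
      = (quad_form V (\<lambda>u v. of_bool (u \<noteq> v)) x + (\<Sum>(u, v)\<in>?F. x u * x v)) / 2"
    by (intro quad_form_diameter_two_kernel R.finite_V R.E_subset H.E_subset)+
  \<comment> \<open>A cycle of inequalities from \<open>harary_radius G\<close> back to itself: all of them are equalities.\<close>
  have "harary_radius G \<le> quad_form V (diameter_two_kernel E) x"
    unfolding x(3)[symmetric] quad_form_def
    by (intro sum_mono mult_right_mono G0.harary_kernel_le_diameter_two_kernel x(1))
  moreover have "quad_form V (diameter_two_kernel E) x \<le> quad_form V (diameter_two_kernel ?F) x"
    unfolding form_E form_F using R.arc_weight_le[of x, OF x(1) c(2)] by simp
  moreover have "quad_form V (diameter_two_kernel ?F) x \<le> harary_radius H.graph"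
    using z[of x] x(2) kernel by simp
  ultimately have tight: "quad_form V H.harary_kernel x = harary_radius H.graph"
    "(\<Sum>(u, v)\<in>E. x u * x v) = (\<Sum>(u, v)\<in>?F. x u * x v)"
    using le kernel form_E form_F by auto
  have eigen: "(\<Sum>v\<in>V. diameter_two_kernel ?F u v * x v) = harary_radius H.graph * x u"
    if "u \<in> V" for u
  proof -
    have "(\<Sum>v\<in>V. H.harary_kernel u v * x v) = harary_radius H.graph * x u"
      by (rule quad_form_maximiser_eigenvector[OF R.finite_V H.harary_kernel_sym z _ that])
        (simp add: tight(1) x(2))
    then show ?thesis
      using that by (simp add: R.pendant_clique_kernel cong: sum.cong)
  qed
  have radius_nonneg: "harary_radius H.graph \<ge> 0"
    unfolding tight(1)[symmetric] kernel unfolding quad_form_def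
    by (intro sum_nonneg mult_nonneg_nonneg x(1)) (simp add: diameter_two_kernel_def)
  have strict: "x v < x c" if "v \<in> V" "w \<in> V" "distinct [c, v, w]" "R.lower_ends \<noteq> {}" for v w
    by (rule R.pendant_clique_eigenvector_root_maximal[of x, OF pos radius_nonneg eigen that])
  have "E = ?F"
    by (rule R.arc_weight_eq_imp_arcs_eq[of x, OF x(1) pos c(2) strict tight(2)])
  \<comment> \<open>As \<open>?F\<close> is itself defined from \<open>E\<close>, this equation would loop as a rewrite rule.\<close>
  then have GH: "G = H.graph"
    unfolding G by (rule arg_cong[where f = "\<lambda>A. \<lparr>pverts = V, parcs = A\<rparr>"])
  have "card (V - R.lower_ends) = n - p"
    using card_Diff_subset[OF finite_subset[OF R.lower_ends_subset R.finite_V] R.lower_ends_subset] n p by simp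
  then show ?thesis
    unfolding GH using R.pendant_clique_iso p by simp
qed

end
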